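(* For every integer $n\ge 0$, let $S_n\subset L^1([0,1])$ be the space of (classes of) piecewise constant functions on $[0,1]$ with values $\pm1$ and at most $n+1$ intervals of constant sign, equipped with the subspace topology from $L^1([0,1])$. Then $S_n$ is homeomorphic to the $n$-dimensional sphere $S^n$.
   Context: Functions are considered as elements of $L^1([0,1])$ (so up to equality almost everywhere). A function belongs to $S_n$ if there is a partition of $[0,1]$ into at most $n+1$ consecutive intervals on each of which it is (a.e.) constantly $+1$ or constantly $-1$. *)

theory Defs
  imports "HOL-Analysis.Analysis"
begin

abbreviation unit_meas :: "real measure"
  where "unit_meas \<equiv> lebesgue_on {0..1}"

text \<open>
  Almost-everywhere equality of integrable functions on \<open>[0,1]\<close>. Functions are total on
  \<open>real\<close>, but their values outside \<open>[0,1]\<close> are irrelevant to both integrability and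
  almost-everywhere equality with respect to \<^term>\<open>unit_meas\<close>.
\<close>

definition L1_eq :: "((real \<Rightarrow> real) \<times> (real \<Rightarrow> real)) set"
  where "L1_eq = {(f, g). integrable unit_meas f \<and> integrable unit_meas g \<and>
                          (AE x in unit_meas. f x = g x)}"

definition L1 :: "(real \<Rightarrow> real) set set"
  where "L1 = {f. integrable unit_meas f} // L1_eq"

text \<open>
  The distance is computed on arbitrarily chosen representatives; \<open>L1_dist_eq\<close> below shows
  that the choice is immaterial.
\<close>

definition L1_dist :: "(real \<Rightarrow> real) set \<Rightarrow> (real \<Rightarrow> real) set \<Rightarrow> real"
  where "L1_dist F G = (LINT x|unit_meas. \<bar>(SOME f. f \<in> F) x - (SOME g. g \<in> G) x\<bar>)"

lemma equiv_L1_eq: "equiv {f. integrable unit_meas f} L1_eq"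
proof (rule equivI)
  show "L1_eq \<subseteq> {f. integrable unit_meas f} \<times> {f. integrable unit_meas f}"
    by (auto simp: L1_eq_def)
  show "refl_on {f. integrable unit_meas f} L1_eq"
    by (auto simp: refl_on_def L1_eq_def)
  show "sym L1_eq"
    by (auto simp: sym_def L1_eq_def elim: eventually_mono)
  show "trans L1_eq"
    unfolding trans_def L1_eq_def by (auto elim: eventually_elim2)
qed

lemma L1_eq_of_mem: "F \<in> L1 \<Longrightarrow> f \<in> F \<Longrightarrow> g \<in> F \<Longrightarrow> (f, g) \<in> L1_eq"
  unfolding L1_def by (rule quotient_eq_iff[OF equiv_L1_eq, THEN iffD1]) auto

lemma L1_integrable: "F \<in> L1 \<Longrightarrow> f \<in> F \<Longrightarrow> integrable unit_meas f"
  using L1_eq_of_mem[of F f f] by (auto simp: L1_eq_def)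

lemma L1_some_mem: "F \<in> L1 \<Longrightarrow> (SOME f. f \<in> F) \<in> F"
  unfolding L1_def using in_quotient_imp_non_empty[OF equiv_L1_eq] by (auto simp: some_in_eq)

lemma L1_dist_eq:
  assumes "F \<in> L1" "G \<in> L1" "f \<in> F" "g \<in> G"
  shows "L1_dist F G = (LINT x|unit_meas. \<bar>f x - g x\<bar>)"
proof -
  let ?f = "SOME f. f \<in> F" and ?g = "SOME g. g \<in> G"
  have *: "(?f, f) \<in> L1_eq" "(?g, g) \<in> L1_eq"
    using assms by (auto intro: L1_eq_of_mem L1_some_mem)
  have [measurable]: "?f \<in> borel_measurable unit_meas" "f \<in> borel_measurable unit_meas"
      "?g \<in> borel_measurable unit_meas" "g \<in> borel_measurable unit_meas"
    using * by (auto simp: L1_eq_def)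
  have "AE x in unit_meas. ?f x = f x" "AE x in unit_meas. ?g x = g x"
    using * by (auto simp: L1_eq_def)
  then have "AE x in unit_meas. \<bar>?f x - ?g x\<bar> = \<bar>f x - g x\<bar>"
    by eventually_elim simp
  then show ?thesis
    unfolding L1_dist_def by (intro integral_cong_AE) measurable
qed

interpretation L1: Metric_space L1 L1_dist
proof
  fix F G H :: "(real \<Rightarrow> real) set"
  show "0 \<le> L1_dist F G"
    unfolding L1_dist_def by (rule integral_nonneg_AE) simp
  show "L1_dist F G = L1_dist G F"
    unfolding L1_dist_def by (simp add: abs_minus_commute)
  show "L1_dist F G = 0 \<longleftrightarrow> F = G" if FG: "F \<in> L1" "G \<in> L1"
  proof -
    obtain f g where fg: "f \<in> F" "g \<in> G"
      using FG L1_some_mem by blast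
    have i: "integrable unit_meas f" "integrable unit_meas g"
      using FG fg L1_integrable by blast+
    have "L1_dist F G = 0 \<longleftrightarrow> (AE x in unit_meas. \<bar>f x - g x\<bar> = 0)"
      unfolding L1_dist_eq[OF FG fg] using i by (intro integral_nonneg_eq_0_iff_AE) auto
    also have "\<dots> \<longleftrightarrow> (f, g) \<in> L1_eq"
      using i by (simp add: L1_eq_def)
    also have "\<dots> \<longleftrightarrow> F = G"
      using quotient_eq_iff[OF equiv_L1_eq FG[unfolded L1_def] fg] by simp
    finally show ?thesis .
  qed
  show "L1_dist F H \<le> L1_dist F G + L1_dist G H" if FGH: "F \<in> L1" "G \<in> L1" "H \<in> L1"
  proof -
    obtain f g h where m: "f \<in> F" "g \<in> G" "h \<in> H"
      using FGH L1_some_mem by blast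
    have i: "integrable unit_meas f" "integrable unit_meas g" "integrable unit_meas h"
      using FGH m L1_integrable by blast+
    have "(LINT x|unit_meas. \<bar>f x - h x\<bar>)
        \<le> (LINT x|unit_meas. \<bar>f x - g x\<bar> + \<bar>g x - h x\<bar>)"
      using i by (intro integral_mono) auto
    also have "\<dots> = (LINT x|unit_meas. \<bar>f x - g x\<bar>) + (LINT x|unit_meas. \<bar>g x - h x\<bar>)"
      using i by (intro Bochner_Integration.integral_add) auto
    finally show ?thesis
      using FGH m by (simp add: L1_dist_eq)
  qed
qed

text \<open>
  \<open>sign_pieces n f\<close>: for some \<open>k \<le> n\<close> there is a partition \<open>0 = t 0 < \<dots> < t (k + 1) = 1\<close>
  into \<open>k + 1\<close> intervals, on each of which \<open>f\<close> is almost everywhere constantly \<open>1\<close> or almost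
  everywhere constantly \<open>-1\<close>. Adjacent intervals may carry the same sign; interval endpoints
  are null sets.
\<close>

definition sign_pieces :: "nat \<Rightarrow> (real \<Rightarrow> real) \<Rightarrow> bool"
  where "sign_pieces n f \<longleftrightarrow>
    (\<exists>k\<le>n. \<exists>t :: nat \<Rightarrow> real. t 0 = 0 \<and> t (Suc k) = 1 \<and> (\<forall>i\<le>k. t i < t (Suc i)) \<and>
      (\<forall>i\<le>k. (AE x in lebesgue_on {t i..t (Suc i)}. f x = 1) \<or>
             (AE x in lebesgue_on {t i..t (Suc i)}. f x = -1)))"

definition sign_space :: "nat \<Rightarrow> (real \<Rightarrow> real) set set"
  where "sign_space n = {F \<in> L1. \<exists>f\<in>F. sign_pieces n f}"

end

(*
  Write p_a for the polynomial with coefficients a_0, ..., a_n. Every element of S_n is the sign of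
  some p_a with a in the unit sphere S^n, and a |-> sgn p_a is continuous into L^1 because p_a has
  only finitely many zeros; so S_n is a quotient of the compact space S^n. The moments
  T(a)_i = integral of sgn(p_a) x^i, normalized to length 1, give a second continuous map
  S^n -> S^n. It has the same fibres: if T(a) = l T(b) with 0 < l <= 1, then
  (sgn p_a - l sgn p_b) p_a is nonnegative with integral 0, hence vanishes almost everywhere.
  It is onto: for c in S^n, let a maximize (c . a) / |p_a|_1; varying a shows that T(a) is a
  positive multiple of c. Two quotient maps with the same fibres have homeomorphic targets.
*)
theory Submission
  imports Defs
begin

section \<open>Signs of polynomials on [0,1] and their moments: integrability and limits\<close>

definition polyval :: "nat \<Rightarrow> (nat \<Rightarrow> real) \<Rightarrow> real \<Rightarrow> real"
  where "polyval n a x = (\<Sum>i\<le>n. a i * x ^ i)"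

definition sgn_moment :: "nat \<Rightarrow> (nat \<Rightarrow> real) \<Rightarrow> nat \<Rightarrow> real"
  where "sgn_moment n a i = (LINT x|unit_meas. sgn (polyval n a x) * x ^ i)"

lemma AE_lebesgue_on_notin_finite:
  assumes "finite A" "S \<in> sets lebesgue"
  shows "AE x in lebesgue_on S. x \<notin> A"
proof -
  have "AE x in lebesgue. x \<notin> A"
    by (rule AE_not_in) (use assms in \<open>simp add: negligible_finite flip: negligible_iff_null_sets\<close>)
  then show ?thesis
    using assms by (subst AE_restrict_space_iff) auto
qed

text \<open>The roots are finite in number, hence a null set, so the jump of \<open>sgn\<close> at 0
  is invisible to integrals.\<close>

lemma AE_polyval_nonzero:
  assumes "\<exists>i\<le>n. a i \<noteq> 0" "S \<in> sets lebesgue"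
  shows "AE x in lebesgue_on S. polyval n a x \<noteq> 0"
proof -
  have "finite {x. polyval n a x = 0}"
    unfolding polyval_def polyfun_finite_roots by (rule assms(1))
  from AE_lebesgue_on_notin_finite[OF this assms(2)] show ?thesis
    by (rule AE_mp) simp
qed

lemma continuous_on_polyval: "continuous_on S (polyval n a)"
  unfolding polyval_def by (intro continuous_intros)

lemma polyval_measurable [measurable]: "polyval n a \<in> borel_measurable (lebesgue_on S)"
  by (intro measurable_restrict_space1 measurable_completion)
     (simp add: borel_measurable_continuous_onI continuous_on_polyval)

lemma ident_measurable [measurable]: "(\<lambda>x::real. x) \<in> borel_measurable (lebesgue_on S)"
  by (intro measurable_restrict_space1 measurable_completion) simp

lemma finite_measure_unit: "finite_measure unit_meas"
  by (intro finite_measure_lebesgue_on) auto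

lemma integrable_unit_bounded:
  fixes f :: "real \<Rightarrow> real"
  assumes "f \<in> borel_measurable unit_meas" "\<And>x. x \<in> {0..1} \<Longrightarrow> \<bar>f x\<bar> \<le> B"
  shows "integrable unit_meas f"
proof (rule finite_measure.integrable_const_bound[OF finite_measure_unit])
  show "AE x in unit_meas. norm (f x) \<le> B"
    by (rule AE_I2) (simp add: assms(2))
qed (rule assms(1))

lemma abs_sgn_le_1: "\<bar>sgn x :: real\<bar> \<le> 1"
  by (simp add: sgn_if)

lemma integrable_sgn_polyval: "integrable unit_meas (\<lambda>x. sgn (polyval n a x))"
  by (rule integrable_unit_bounded[where B = 1]) (auto simp: abs_sgn_le_1)

lemma integrable_sgn_power: "integrable unit_meas (\<lambda>x. sgn (polyval n a x) * x ^ i)"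
proof (rule integrable_unit_bounded[where B = 1])
  show "\<bar>sgn (polyval n a x) * x ^ i\<bar> \<le> 1" if "x \<in> {0..1}" for x
    using that by (auto simp: abs_mult abs_sgn_le_1 power_abs[symmetric] intro!: mult_le_one power_le_one)
qed measurable

text \<open>
  Off the finitely many zeros of the limit polynomial the signs are eventually constant, so no
  continuity of \<open>f\<close> in its first argument is needed.
\<close>
lemma integral_sgn_polyval_tendsto:
  fixes f :: "real \<Rightarrow> real \<Rightarrow> real"
  assumes meas: "\<And>s. f s \<in> borel_measurable unit_meas"
    and bound: "\<And>s x. \<bar>s\<bar> \<le> 1 \<Longrightarrow> x \<in> {0..1} \<Longrightarrow> \<bar>f s x\<bar> \<le> B"
    and nz: "\<exists>i\<le>n. a i \<noteq> 0"
    and lim: "\<And>i. i \<le> n \<Longrightarrow> (\<lambda>k. b k i) \<longlonglongrightarrow> a i"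
  shows "(\<lambda>k. LINT x|unit_meas. f (sgn (polyval n (b k) x)) x)
           \<longlonglongrightarrow> (LINT x|unit_meas. f (sgn (polyval n a x)) x)"
proof (rule integral_dominated_convergence[where w = "\<lambda>_. B"])
  have m: "(\<lambda>x. f (sgn (polyval n c x)) x) \<in> borel_measurable unit_meas" for c
  proof -
    \<comment> \<open>Measurability of \<open>f\<close> is given only for each fixed first argument;
      since \<open>sgn\<close> takes three values, the composite is a case split among three such
      functions.\<close>
    have "(\<lambda>x. f (sgn (polyval n c x)) x) =
        (\<lambda>x. if polyval n c x > 0 then f 1 x else if polyval n c x < 0 then f (-1) x else f 0 x)"
      by (auto simp: fun_eq_iff sgn_if)
    also have "\<dots> \<in> borel_measurable unit_meas"
      by (intro measurable_If meas) measurable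
    finally show ?thesis .
  qed
  show "(\<lambda>x. f (sgn (polyval n a x)) x) \<in> borel_measurable unit_meas" by (rule m)
  show "(\<lambda>x. f (sgn (polyval n (b k) x)) x) \<in> borel_measurable unit_meas" for k by (rule m)
  show "integrable unit_meas (\<lambda>_. B)"
    by (rule integrable_unit_bounded[where B = "\<bar>B\<bar>"]) simp_all
  show "AE x in unit_meas. norm (f (sgn (polyval n (b k) x)) x) \<le> B" for k
    unfolding real_norm_def by (intro AE_I2 bound abs_sgn_le_1) simp
  show "AE x in unit_meas. (\<lambda>k. f (sgn (polyval n (b k) x)) x) \<longlonglongrightarrow> f (sgn (polyval n a x)) x"
  proof -
    have "AE x in unit_meas. polyval n a x \<noteq> 0"
      by (rule AE_polyval_nonzero[OF nz]) simp
    then show ?thesis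
    proof eventually_elim
      case (elim x)
      have L: "(\<lambda>k. polyval n (b k) x) \<longlonglongrightarrow> polyval n a x"
        unfolding polyval_def by (intro tendsto_intros lim) auto
      have "\<forall>\<^sub>F k in sequentially. sgn (polyval n (b k) x) = sgn (polyval n a x)"
      proof (cases "polyval n a x > 0")
        case True
        show ?thesis
          using order_tendstoD(1)[OF L True] by eventually_elim (use True in auto)
      next
        case False
        then have "polyval n a x < 0" using elim by auto
        show ?thesis
          using order_tendstoD(2)[OF L \<open>polyval n a x < 0\<close>]
          by eventually_elim (use \<open>polyval n a x < 0\<close> in auto)
      qed
      then show ?case
        by (intro tendsto_eventually) (erule eventually_mono, simp)
    qed
  qed
qed

lemma sgn_moment_tendsto:
  assumes "\<exists>i\<le>n. a i \<noteq> 0" "\<And>i. i \<le> n \<Longrightarrow> (\<lambda>k. b k i) \<longlonglongrightarrow> a i"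
  shows "(\<lambda>k. sgn_moment n (b k) j) \<longlonglongrightarrow> sgn_moment n a j"
  unfolding sgn_moment_def
proof (rule integral_sgn_polyval_tendsto[where B = 1])
  show "\<bar>s * x ^ j\<bar> \<le> 1" if "\<bar>s\<bar> \<le> 1" "x \<in> {0..1}" for s x :: real
    using that by (auto simp: abs_mult power_abs[symmetric] intro!: mult_le_one power_le_one)
qed (use assms in auto)

text \<open>The product topology on \<open>nat \<Rightarrow> real\<close> is first countable, so
  sequences decide continuity, and convergence there gives convergence of every coefficient. The
  premise is shaped to fit the limit lemmas above.\<close>

lemma continuous_on_nonzero_coeffsI:
  fixes \<phi> :: "(nat \<Rightarrow> real) \<Rightarrow> real"
  assumes "\<And>a b. a \<in> S \<Longrightarrow> \<exists>i\<le>n. a i \<noteq> 0 \<Longrightarrow>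
      (\<And>i. i \<le> n \<Longrightarrow> (\<lambda>k. b k i) \<longlonglongrightarrow> a i) \<Longrightarrow> (\<lambda>k. \<phi> (b k)) \<longlonglongrightarrow> \<phi> a"
    and "\<And>a. a \<in> S \<Longrightarrow> \<exists>i\<le>n. a i \<noteq> 0"
  shows "continuous_on S \<phi>"
proof (rule continuous_on_sequentiallyI)
  fix b a assume *: "\<forall>k. b k \<in> S" "a \<in> S" "b \<longlonglongrightarrow> a"
  have "(\<lambda>k. b k i) \<longlonglongrightarrow> a i" for i
    using continuous_on_tendsto_compose[OF continuous_on_product_coordinates *(3), of i] by simp
  then show "(\<lambda>k. \<phi> (b k)) \<longlonglongrightarrow> \<phi> a"
    using assms * by blast
qed

section \<open>Pairing coefficients with moments, and recovering the sign from the moments\<close>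

text \<open>Linearity of the integral. For \<open>c = a\<close> the right-hand side is the L^1 norm
  of p_a on [0,1].\<close>

lemma sum_sgn_moment:
  "(\<Sum>i\<le>n. c i * sgn_moment n a i) = (LINT x|unit_meas. sgn (polyval n a x) * polyval n c x)"
proof -
  have "(LINT x|unit_meas. sgn (polyval n a x) * polyval n c x)
      = (LINT x|unit_meas. (\<Sum>i\<le>n. c i * (sgn (polyval n a x) * x ^ i)))"
    unfolding polyval_def[of n c] by (simp add: sum_distrib_left mult.left_commute)
  also have "\<dots> = (\<Sum>i\<le>n. LINT x|unit_meas. c i * (sgn (polyval n a x) * x ^ i))"
    by (intro Bochner_Integration.integral_sum integrable_mult_right integrable_sgn_power)
  finally show ?thesis by (simp add: sgn_moment_def)
qed

lemma integrable_sgn_mult_polyval: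
  "integrable unit_meas (\<lambda>x. sgn (polyval n a x) * polyval n c x)"
proof -
  have "integrable unit_meas (\<lambda>x. \<Sum>i\<le>n. c i * (sgn (polyval n a x) * x ^ i))"
    by (intro Bochner_Integration.integrable_sum integrable_mult_right integrable_sgn_power)
  then show ?thesis
    unfolding polyval_def[of n c] by (simp add: sum_distrib_left mult.left_commute)
qed

text \<open>Pointwise \<open>sgn u * v\<close> is at most |v|, with equality for u = v: among all
  polynomial signs, a polynomial pairs best with its own.\<close>

lemma sum_sgn_moment_le:
  "(\<Sum>i\<le>n. c i * sgn_moment n b i) \<le> (\<Sum>i\<le>n. c i * sgn_moment n c i)"
  unfolding sum_sgn_moment
  by (intro integral_mono integrable_sgn_mult_polyval) (auto simp: sgn_if)

text \<open>Equality of moments makes sgn p_a - l sgn p_b orthogonal to p_a. As 0 <= l <= 1, its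
  product with p_a is nonnegative, so it vanishes almost everywhere, and p_a can be cancelled off
  its roots.\<close>

lemma sgn_eq_scaled_if_moments_scaled:
  assumes a: "\<exists>i\<le>n. a i \<noteq> 0" and "0 \<le> l" "l \<le> 1"
    and eq: "\<And>i. i \<le> n \<Longrightarrow> sgn_moment n a i = l * sgn_moment n b i"
  shows "AE x in unit_meas. sgn (polyval n a x) = l * sgn (polyval n b x)"
proof -
  let ?g = "\<lambda>x. sgn (polyval n a x) * polyval n a x - l * (sgn (polyval n b x) * polyval n a x)"
  have "(LINT x|unit_meas. ?g x) = (\<Sum>i\<le>n. a i * sgn_moment n a i) - l * (\<Sum>i\<le>n. a i * sgn_moment n b i)"
    unfolding sum_sgn_moment
    by (subst Bochner_Integration.integral_diff) (auto intro!: integrable_sgn_mult_polyval integrable_mult_right)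
  also have "\<dots> = 0"
    using eq by (simp add: sum_distrib_left mult_ac)
  finally have 0: "(LINT x|unit_meas. ?g x) = 0" .
  have ge: "?g x \<ge> 0" for x
  proof -
    have "l * (sgn (polyval n b x) * polyval n a x) \<le> l * \<bar>polyval n a x\<bar>"
      using assms by (intro mult_left_mono) (auto simp: sgn_if)
    also have "\<dots> \<le> 1 * \<bar>polyval n a x\<bar>"
      using assms by (intro mult_right_mono) auto
    also have "1 * \<bar>polyval n a x\<bar> = sgn (polyval n a x) * polyval n a x"
      by (simp add: sgn_if)
    finally show ?thesis by simp
  qed
  have "AE x in unit_meas. ?g x = 0"
    using 0 by (subst integral_nonneg_eq_0_iff_AE[symmetric])
      (use ge in \<open>auto intro!: integrable_sgn_mult_polyval integrable_mult_right\<close>)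
  moreover have "AE x in unit_meas. polyval n a x \<noteq> 0"
    by (rule AE_polyval_nonzero[OF a]) simp
  ultimately show ?thesis
    by eventually_elim (auto simp: algebra_simps)
qed

text \<open>Exchanging a and b replaces l by 1 / l, which reduces to a factor at most 1. Applying
  \<open>sgn\<close> once more then removes the positive factor.\<close>

lemma sgn_eq_if_moments_proportional:
  assumes a: "\<exists>i\<le>n. a i \<noteq> 0" and b: "\<exists>i\<le>n. b i \<noteq> 0" and l: "0 < l"
    and eq: "\<And>i. i \<le> n \<Longrightarrow> sgn_moment n a i = l * sgn_moment n b i"
  shows "AE x in unit_meas. sgn (polyval n a x) = sgn (polyval n b x)"
proof (cases "l \<le> 1")
  case True
  have "AE x in unit_meas. sgn (polyval n a x) = l * sgn (polyval n b x)"
    using sgn_eq_scaled_if_moments_scaled[OF a _ True eq] l by simp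
  then show ?thesis
  proof eventually_elim
    case (elim x)
    then have "sgn (sgn (polyval n a x)) = sgn (l * sgn (polyval n b x))" by simp
    then show ?case using l by (simp add: sgn_mult)
  qed
next
  case False
  have "AE x in unit_meas. sgn (polyval n b x) = (1 / l) * sgn (polyval n a x)"
    by (rule sgn_eq_scaled_if_moments_scaled[OF b]) (use False l eq in \<open>auto simp: field_simps\<close>)
  then show ?thesis
  proof eventually_elim
    case (elim x)
    then have "sgn (sgn (polyval n b x)) = sgn ((1 / l) * sgn (polyval n a x))" by simp
    then show ?case using l by (simp add: sgn_mult)
  qed
qed

text \<open>The sum is the L^1 norm of p_a; if it were 0, then p_a would vanish almost everywhere,
  against the finiteness of its roots.\<close>

lemma sum_sgn_moment_pos:
  assumes "\<exists>i\<le>n. a i \<noteq> 0"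
  shows "0 < (\<Sum>i\<le>n. a i * sgn_moment n a i)"
proof (rule ccontr)
  have ge: "0 \<le> sgn (polyval n a x) * polyval n a x" for x
    by (simp add: sgn_if)
  assume "\<not> ?thesis"
  moreover have "0 \<le> (LINT x|unit_meas. sgn (polyval n a x) * polyval n a x)"
    using ge by simp
  ultimately have "(LINT x|unit_meas. sgn (polyval n a x) * polyval n a x) = 0"
    unfolding sum_sgn_moment by linarith
  then have "AE x in unit_meas. sgn (polyval n a x) * polyval n a x = 0"
    by (subst (asm) integral_nonneg_eq_0_iff_AE) (use ge in \<open>auto intro!: integrable_sgn_mult_polyval\<close>)
  moreover have "AE x in unit_meas. polyval n a x \<noteq> 0"
    by (rule AE_polyval_nonzero[OF assms]) simp
  \<comment> \<open>Both facts together would give [0,1] measure 0.\<close>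
  ultimately have "AE x in unit_meas. False"
    by eventually_elim (auto simp: sgn_if split: if_splits)
  then have "emeasure unit_meas (space unit_meas) = 0"
    by (subst (asm) AE_iff_measurable[OF sets.top]) auto
  then show False
    by (simp add: emeasure_restrict_space)
qed

subsection \<open>The unit sphere of coefficients\<close>

lemma topspace_nsphere:
  "topspace (nsphere n) = {x. (\<Sum>i\<le>n. (x i)\<^sup>2) = 1 \<and> (\<forall>i>n. x i = 0)}"
  by (simp add: nsphere)

text \<open>Connects the abstract topology of \<open>nsphere\<close> with the type class topology on
  sequences, so that \<open>compact\<close> and \<open>continuous_on\<close> become
  available.\<close>

lemma nsphere_eq_top_of_set: "nsphere n = top_of_set (topspace (nsphere n))"
  unfolding topspace_nsphere by (simp add: nsphere euclidean_product_topology)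

lemma nsphere_nonzero: "a \<in> topspace (nsphere n) \<Longrightarrow> \<exists>i\<le>n. a i \<noteq> 0"
  unfolding topspace_nsphere by (rule ccontr) auto

text \<open>The ambient space consists of infinite sequences, so compactness comes from Tychonoff:
  the sphere is a closed subset of the cube of sequences with entries in [-1,1].\<close>

lemma compact_topspace_nsphere: "compact (topspace (nsphere n))"
proof -
  let ?K = "PiE UNIV (\<lambda>_::nat. {-1..1::real})"
  have "compactin (product_topology (\<lambda>_. euclidean) UNIV) ?K"
    by (subst compactin_PiE) auto
  then have K: "compact ?K"
    by (simp add: euclidean_product_topology)
  have "closed (topspace (nsphere n))"
    unfolding topspace_nsphere
    by (intro closed_Collect_conj closed_Collect_eq closed_Collect_all closed_Collect_imp
          continuous_intros continuous_on_product_coordinates) auto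
  moreover have "topspace (nsphere n) \<subseteq> ?K"
  proof
    fix x assume "x \<in> topspace (nsphere n)"
    then have x: "(\<Sum>i\<le>n. (x i)\<^sup>2) = 1" "\<And>i. i > n \<Longrightarrow> x i = 0"
      by (auto simp: topspace_nsphere)
    have "\<bar>x i\<bar> \<le> 1" for i
    proof (cases "i \<le> n")
      case True
      then have "(x i)\<^sup>2 \<le> 1"
        using x(1) member_le_sum[of i "{..n}" "\<lambda>i. (x i)\<^sup>2"] by auto
      then show ?thesis by (simp add: abs_square_le_1)
    qed (use x in auto)
    then show "x \<in> ?K" by (auto simp: abs_le_iff minus_le_iff)
  qed
  ultimately show ?thesis
    using K compact_Int_closed[of ?K "topspace (nsphere n)"] by (simp add: Int_absorb1)
qed

lemma compact_space_nsphere: "compact_space (nsphere n)"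
  using compact_topspace_nsphere nsphere_eq_top_of_set
  by (metis compact_space_subtopology compactin_euclidean_iff)

lemma sum_squares_pos:
  fixes a :: "nat \<Rightarrow> real"
  assumes "\<exists>i\<le>n. a i \<noteq> 0"
  shows "0 < (\<Sum>i\<le>n. (a i)\<^sup>2)"
  using assms by (auto intro!: sum_pos2)

definition sphere_normalize :: "nat \<Rightarrow> (nat \<Rightarrow> real) \<Rightarrow> nat \<Rightarrow> real"
  where "sphere_normalize n a i = (if i \<le> n then a i / sqrt (\<Sum>j\<le>n. (a j)\<^sup>2) else 0)"

lemma sphere_normalize_in_nsphere:
  assumes "\<exists>i\<le>n. a i \<noteq> 0"
  shows "sphere_normalize n a \<in> topspace (nsphere n)"
  using sum_squares_pos[OF assms]
  by (auto simp: topspace_nsphere sphere_normalize_def power_divide sum_divide_distrib[symmetric])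

lemma polyval_scale:
  assumes "\<And>i. i \<le> n \<Longrightarrow> b i = r * a i"
  shows "polyval n b x = r * polyval n a x"
  using assms by (simp add: polyval_def sum_distrib_left mult_ac)

lemma sgn_polyval_scale:
  assumes "\<And>i. i \<le> n \<Longrightarrow> b i = r * a i" "r > 0"
  shows "sgn (polyval n b x) = sgn (polyval n a x)"
  using assms by (simp add: polyval_scale[OF assms(1)] sgn_mult)

lemma sphere_normalize_scale:
  assumes "\<exists>i\<le>n. a i \<noteq> 0"
  obtains r where "r > 0" "\<And>i. i \<le> n \<Longrightarrow> sphere_normalize n a i = r * a i"
  using sum_squares_pos[OF assms]
  by (intro that[of "1 / sqrt (\<Sum>j\<le>n. (a j)\<^sup>2)"]) (auto simp: sphere_normalize_def)

section \<open>Every direction is realized by sign moments\<close>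

text \<open>Otherwise the pairing of the moments with a, the L^1 norm of p_a, would be 0. This makes
  the moment vector normalizable.\<close>

lemma sgn_moment_nonzero:
  assumes "\<exists>i\<le>n. a i \<noteq> 0"
  shows "\<exists>i\<le>n. sgn_moment n a i \<noteq> 0"
  using sum_sgn_moment_pos[OF assms] by (rule contrapos_pp) auto

text \<open>
  The coefficients of the polynomial come from maximizing \<open>c \<bullet> a / \<parallel>p\<^sub>a\<parallel>\<^sub>1\<close> over the sphere; the
  first-order condition at a maximizer says that its sign moments are proportional to \<open>c\<close>.
\<close>
lemma sgn_moment_surj:
  assumes c: "c \<in> topspace (nsphere n)"
  obtains a M where "a \<in> topspace (nsphere n)" "M > 0" "\<And>i. i \<le> n \<Longrightarrow> c i = M * sgn_moment n a i"
proof -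
  \<comment> \<open>\<open>N a\<close> is the L^1 norm of p_a. The quotient \<open>R\<close> is
    invariant under positive scaling, so its maximum on the sphere bounds it at all nonzero
    coefficient vectors.\<close>
  define N where "N a = (\<Sum>i\<le>n. a i * sgn_moment n a i)" for a
  define R where "R a = (\<Sum>i\<le>n. c i * a i) / N a" for a
  have Npos: "N a > 0" if "\<exists>i\<le>n. a i \<noteq> 0" for a
    using sum_sgn_moment_pos[OF that] by (simp add: N_def)
  have "continuous_on (topspace (nsphere n)) R"
  proof (rule continuous_on_nonzero_coeffsI)
    fix a and b :: "nat \<Rightarrow> nat \<Rightarrow> real"
    assume nz: "\<exists>i\<le>n. a i \<noteq> 0" and lim: "\<And>i. i \<le> n \<Longrightarrow> (\<lambda>k. b k i) \<longlonglongrightarrow> a i"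
    show "(\<lambda>k. R (b k)) \<longlonglongrightarrow> R a"
      unfolding R_def N_def
      by (intro tendsto_intros lim sgn_moment_tendsto nz) (use Npos[OF nz] in \<open>auto simp: N_def\<close>)
  qed (rule nsphere_nonzero)
  then obtain a where a: "a \<in> topspace (nsphere n)"
      and max: "\<And>b. b \<in> topspace (nsphere n) \<Longrightarrow> R b \<le> R a"
    using continuous_attains_sup[OF compact_topspace_nsphere, of n R] c by blast
  define M where "M = R a"
  \<comment> \<open>At \<open>c\<close> itself the numerator is the squared length 1, so the maximum
    is positive.\<close>
  have "0 < R c"
    using c Npos[OF nsphere_nonzero[OF c]] by (simp add: R_def topspace_nsphere power2_eq_square)
  then have M: "M > 0" using max[OF c] by (simp add: M_def)
  have nza: "\<exists>i\<le>n. a i \<noteq> 0" using a by (rule nsphere_nonzero)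
  have eqa: "(\<Sum>i\<le>n. c i * a i) = M * N a"
    using Npos[OF nza] by (simp add: M_def R_def)
  have le: "(\<Sum>i\<le>n. c i * b i) \<le> M * N b" for b
  proof (cases "\<exists>i\<le>n. b i \<noteq> 0")
    case False
    then show ?thesis by (simp add: N_def)
  next
    case True
    then obtain r where r: "r > 0" "\<And>i. i \<le> n \<Longrightarrow> sphere_normalize n b i = r * b i"
      using sphere_normalize_scale[of n b] by blast
    let ?b = "sphere_normalize n b"
    have "sgn_moment n ?b i = sgn_moment n b i" for i
      unfolding sgn_moment_def by (subst sgn_polyval_scale[OF r(2,1)]) auto
    then have "N ?b = r * N b"
      unfolding N_def by (simp add: r sum_distrib_left mult_ac)
    moreover have "(\<Sum>i\<le>n. c i * ?b i) = r * (\<Sum>i\<le>n. c i * b i)"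
      by (simp add: r sum_distrib_left mult_ac)
    ultimately have "R ?b = R b" using r by (simp add: R_def)
    then have "R b \<le> M"
      using max[OF sphere_normalize_in_nsphere[OF True]] by (simp add: M_def)
    then show ?thesis
      using Npos[OF True] by (simp add: R_def field_simps)
  qed
  have var: "e * c j \<le> e * (M * sgn_moment n a j)" if j: "j \<le> n" for j and e :: real
  proof -
    \<comment> \<open>The maximizer is moved along the j-th axis by e / (k + 1); the choices e = 1
      and e = -1 will give the two halves of an equality.\<close>
    define b where "b k i = a i + (if i = j then e / real (Suc k) else 0)" for k i
    have sum_b: "(\<Sum>i\<le>n. b k i * y i) = (\<Sum>i\<le>n. a i * y i) + e / real (Suc k) * y j" for k and y :: "nat \<Rightarrow> real"
    proof -
      have "(\<Sum>i\<le>n. b k i * y i) = (\<Sum>i\<le>n. a i * y i + (if i = j then e / real (Suc k) * y j else 0))"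
        by (intro sum.cong refl) (simp add: b_def distrib_right)
      then show ?thesis
        using j by (simp add: sum.distrib)
    qed
    have bound: "e * c j \<le> M * (e * sgn_moment n (b k) j)" for k
    proof -
      have "(\<Sum>i\<le>n. c i * a i) + e / real (Suc k) * c j = (\<Sum>i\<le>n. c i * b k i)"
        using sum_b[of k c] by (simp add: mult.commute)
      also have "\<dots> \<le> M * N (b k)" by (rule le)
      also have "N (b k) = (\<Sum>i\<le>n. a i * sgn_moment n (b k) i) + e / real (Suc k) * sgn_moment n (b k) j"
        unfolding N_def by (rule sum_b)
      \<comment> \<open>The first sum is at most \<open>N a\<close>, because p_a has the best sign
        for pairing with a. By \<open>eqa\<close>, \<open>M * N a\<close> then cancels against the
        sum of the \<open>c i * a i\<close>, and only terms with the factor e / (k + 1)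
        remain.\<close>
      also have "M * \<dots> \<le> M * (N a + e / real (Suc k) * sgn_moment n (b k) j)"
        unfolding N_def using M by (intro mult_left_mono add_right_mono sum_sgn_moment_le) auto
      finally have "e / real (Suc k) * c j \<le> M * (e / real (Suc k) * sgn_moment n (b k) j)"
        by (simp add: eqa distrib_left)
      then have "(e * c j) / real (Suc k) \<le> (M * (e * sgn_moment n (b k) j)) / real (Suc k)"
        by (simp add: mult_ac)
      then show ?thesis
        by (subst (asm) divide_le_cancel) auto
    qed
    have "(\<lambda>k. M * (e * sgn_moment n (b k) j)) \<longlonglongrightarrow> M * (e * sgn_moment n a j)"
    proof (intro tendsto_intros sgn_moment_tendsto nza)
      fix i
      have "(\<lambda>k. e / real (Suc k)) \<longlonglongrightarrow> 0"
        by (intro LIMSEQ_Suc lim_const_over_n)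
      then show "(\<lambda>k. b k i) \<longlonglongrightarrow> a i"
        using tendsto_add[OF tendsto_const[of "a i"], of "\<lambda>k. e / real (Suc k)" 0]
        unfolding b_def by (cases "i = j") auto
    qed
    then have "e * c j \<le> M * (e * sgn_moment n a j)"
      by (rule LIMSEQ_le_const) (use bound in auto)
    then show ?thesis by (simp add: mult_ac)
  qed
  have "c j = M * sgn_moment n a j" if "j \<le> n" for j
    using var[OF that, of 1] var[OF that, of "-1"] by simp
  with a M show ?thesis by (rule that)
qed

subsection \<open>Signs of polynomials and piecewise constant functions\<close>

text \<open>Induction on the number of breakpoints. A sign change at \<open>t (Suc k)\<close> comes
  from multiplying by the linear factor \<open>t (Suc k)\<close> - x, positive to the left and
  negative to the right; without a change p is kept. The last piece is a full ray so that the next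
  breakpoint can split it.\<close>

lemma exists_poly_with_signs:
  fixes t :: "nat \<Rightarrow> real" and s :: "nat \<Rightarrow> real"
  assumes "\<And>i. i \<le> k \<Longrightarrow> s i = 1 \<or> s i = -1" "\<And>i. i \<le> k \<Longrightarrow> t i < t (Suc i)"
  shows "\<exists>p :: real poly. degree p \<le> k \<and>
    (\<forall>i<k. \<forall>x. t i < x \<and> x < t (Suc i) \<longrightarrow> s i * poly p x > 0) \<and> (\<forall>x>t k. s k * poly p x > 0)"
  using assms
proof (induction k)
  case 0
  then show ?case
    by (intro exI[of _ "[:s 0:]"]) auto
next
  case (Suc k)
  then obtain p where p: "degree p \<le> k"
      "\<And>i x. i < k \<Longrightarrow> t i < x \<Longrightarrow> x < t (Suc i) \<Longrightarrow> s i * poly p x > 0"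
      "\<And>x. x > t k \<Longrightarrow> s k * poly p x > 0"
    by (metis le_SucI)
  show ?case
  proof (cases "s (Suc k) = s k")
    case True
    show ?thesis
      using p Suc.prems(2)[of k] True
      by (intro exI[of _ p]) (auto simp: less_Suc_eq intro: less_trans)
  next
    case False
    then have flip: "s (Suc k) = - s k"
      using Suc.prems(1)[of k] Suc.prems(1)[of "Suc k"] by auto
    \<comment> \<open>All earlier pieces lie to the left of the new root, where the new factor is
      positive.\<close>
    have mono: "t i \<le> t (Suc k)" if "i \<le> Suc k" for i
      using that
    proof (induction i rule: inc_induct)
      case (step m)
      then show ?case using Suc.prems(2)[of m] by simp
    qed simp
    let ?q = "p * [:t (Suc k), -1:]"
    have "degree ?q \<le> Suc k"
      using degree_mult_le[of p "[:t (Suc k), -1:]"] p(1) by simp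
    moreover have "s i * poly ?q x > 0" if "i < Suc k" "t i < x" "x < t (Suc i)" for i x
    proof -
      have "s i * poly p x > 0"
        using p(2)[of i x] p(3)[of x] that by (cases "i = k") auto
      moreover have "x < t (Suc k)" using mono[of "Suc i"] that by simp
      ultimately have "(s i * poly p x) * (t (Suc k) - x) > 0" by simp
      then show ?thesis by (simp add: algebra_simps)
    qed
    moreover have "s (Suc k) * poly ?q x > 0" if "t (Suc k) < x" for x
    proof -
      have "s k * poly p x > 0"
        using p(3)[of x] that Suc.prems(2)[of k] by simp
      then have "(s k * poly p x) * (x - t (Suc k)) > 0"
        using that by simp
      then show ?thesis by (simp add: flip algebra_simps)
    qed
    ultimately show ?thesis by blast
  qed
qed

text \<open>The least j with \<open>x \<le> t j\<close> is positive, and its predecessor is the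
  index sought.\<close>

lemma between_consecutive:
  fixes t :: "nat \<Rightarrow> 'a::linorder"
  assumes "t 0 < x" "x \<le> t m"
  obtains i where "i < m" "t i < x" "x \<le> t (Suc i)"
proof -
  define j where "j = (LEAST j. x \<le> t j)"
  have j: "x \<le> t j" "j \<le> m"
    unfolding j_def using assms(2) by (auto intro: LeastI Least_le)
  with assms(1) obtain i where i: "j = Suc i"
    by (cases j) auto
  moreover have "\<not> x \<le> t i"
    using not_less_Least[of i "\<lambda>j. x \<le> t j"] i by (simp add: j_def)
  ultimately show ?thesis
    using that[of i] j by auto
qed

text \<open>Sign changes are prescribed only at the interior breakpoints t 1, ..., t k, so degree at
  most k <= n suffices. Scaling the coefficients to unit length keeps the sign.\<close>

lemma sign_pieces_imp_sgn_polyval: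
  assumes "sign_pieces n f"
  obtains a where "a \<in> topspace (nsphere n)" "AE x in unit_meas. f x = sgn (polyval n a x)"
proof -
  obtain k t where k: "k \<le> n" and t: "t 0 = 0" "t (Suc k) = 1" "\<And>i. i \<le> k \<Longrightarrow> t i < t (Suc i)"
    and f: "\<And>i. i \<le> k \<Longrightarrow> (AE x in lebesgue_on {t i..t (Suc i)}. f x = 1) \<or>
             (AE x in lebesgue_on {t i..t (Suc i)}. f x = -1)"
    using assms unfolding sign_pieces_def by blast
  \<comment> \<open>Where f is not almost everywhere 1 on a piece, the hypothesis leaves only
    -1.\<close>
  define s :: "nat \<Rightarrow> real" where
    "s i = (if AE x in lebesgue_on {t i..t (Suc i)}. f x = 1 then 1 else -1)" for i
  have s: "s i = 1 \<or> s i = -1" for i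
    by (simp add: s_def)
  have fs: "AE x in lebesgue. x \<in> {t i..t (Suc i)} \<longrightarrow> f x = s i" if "i \<le> k" for i
  proof -
    have "AE x in lebesgue_on {t i..t (Suc i)}. f x = s i"
      using f[OF that] by (auto simp: s_def)
    then show ?thesis
      by (subst (asm) AE_restrict_space_iff) auto
  qed
  obtain p :: "real poly" where p: "degree p \<le> k"
      "\<And>i x. i < k \<Longrightarrow> t i < x \<Longrightarrow> x < t (Suc i) \<Longrightarrow> s i * poly p x > 0"
      "\<And>x. x > t k \<Longrightarrow> s k * poly p x > 0"
    using exists_poly_with_signs[of k s t] s t(3) by blast
  have p': "s i * poly p x > 0" if "i \<le> k" "t i < x" "x < t (Suc i)" for i x
    using p(2)[of i x] p(3)[of x] that by (cases "i = k") auto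
  have poly: "poly p x = polyval n (coeff p) x" for x
  proof -
    have "poly p x = poly (\<Sum>i\<le>n. monom (coeff p i) i) x"
      using p(1) k by (subst poly_as_sum_of_monoms') auto
    then show ?thesis
      by (simp add: poly_sum poly_monom polyval_def)
  qed
  have nz: "\<exists>i\<le>n. coeff p i \<noteq> 0"
  proof (rule ccontr)
    assume "\<not> ?thesis"
    then have "poly p (t k + 1) = 0"
      by (simp add: poly polyval_def)
    then show False using p(3)[of "t k + 1"] by simp
  qed
  obtain r where r: "r > 0" "\<And>i. i \<le> n \<Longrightarrow> sphere_normalize n (coeff p) i = r * coeff p i"
    using sphere_normalize_scale[OF nz] by blast
  have sgn_eq: "sgn (polyval n (sphere_normalize n (coeff p)) x) = sgn (poly p x)" for x
    unfolding poly by (rule sgn_polyval_scale[OF r(2,1)])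
  \<comment> \<open>The exceptional null sets of the finitely many pieces and the breakpoints are
    discarded together; every remaining x in [0,1] lies strictly inside one piece.\<close>
  have "AE x in lebesgue. \<forall>i\<in>{..k}. x \<in> {t i..t (Suc i)} \<longrightarrow> f x = s i"
    using fs by (intro AE_finite_allI) auto
  moreover have "AE x in lebesgue_on UNIV. x \<notin> t ` {..Suc k}"
    by (rule AE_lebesgue_on_notin_finite) auto
  then have "AE x in lebesgue. x \<notin> t ` {..Suc k}"
    by (subst (asm) AE_restrict_space_iff) auto
  ultimately have "AE x in lebesgue. x \<in> {0..1} \<longrightarrow> f x = sgn (poly p x)"
  proof eventually_elim
    case (elim x)
    show ?case
    proof
      assume x: "x \<in> {0..1}"
      have "x \<noteq> t i" if "i \<le> Suc k" for i
        using elim(2) that by auto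
      note ne = this
      have "t 0 < x" "x \<le> t (Suc k)"
        using x ne[of 0] t by auto
      then obtain i where i: "i < Suc k" "t i < x" "x \<le> t (Suc i)"
        by (rule between_consecutive)
      have "s i * poly p x > 0"
        using i ne[of "Suc i"] by (intro p') auto
      moreover have "f x = s i"
        using elim(1) i by auto
      ultimately show "f x = sgn (poly p x)"
        using s[of i] by auto
    qed
  qed
  then have "AE x in unit_meas. f x = sgn (polyval n (sphere_normalize n (coeff p)) x)"
    unfolding sgn_eq by (subst AE_restrict_space_iff) auto
  with sphere_normalize_in_nsphere[OF nz] show ?thesis
    by (rule that)
qed

text \<open>Two opposite signs would force a zero in between, by the intermediate value
  theorem.\<close>

lemma sgn_constant_between_zeros:
  fixes g :: "real \<Rightarrow> real"
  assumes cont: "continuous_on UNIV g" and nz: "\<And>x. u < x \<Longrightarrow> x < v \<Longrightarrow> g x \<noteq> 0"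
  shows "(\<forall>x. u < x \<and> x < v \<longrightarrow> sgn (g x) = 1) \<or> (\<forall>x. u < x \<and> x < v \<longrightarrow> sgn (g x) = -1)"
proof (rule ccontr)
  assume "\<not> ?thesis"
  then obtain x y where xy: "u < x" "x < v" "u < y" "y < v" "g x < 0" "g y > 0"
    using nz by (fastforce simp: sgn_if split: if_splits)
  have c: "continuous_on {a..b} g" for a b
    using cont continuous_on_subset by blast
  have "\<exists>z. u < z \<and> z < v \<and> g z = 0"
  proof (cases "x \<le> y")
    case True
    then obtain z where "x \<le> z" "z \<le> y" "g z = 0"
      using IVT'[of g x 0 y] c[of x y] xy by auto
    then show ?thesis
      using xy by (intro exI[of _ z]) auto
  next
    case False
    then obtain z where "y \<le> z" "z \<le> x" "g z = 0"
      using IVT2'[of g x 0 y] c[of y x] xy by auto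
    then show ?thesis
      using xy by (intro exI[of _ z]) auto
  qed
  with nz show False by blast
qed

text \<open>Cut [0,1] at the roots: there are at most n of them, hence at most n + 1 pieces, and the
  sign is constant inside each.\<close>

lemma sign_pieces_sgn_polyval:
  assumes nz: "\<exists>i\<le>n. a i \<noteq> 0"
  shows "sign_pieces n (\<lambda>x. sgn (polyval n a x))"
proof -
  \<comment> \<open>Roots at 0 and 1 are left out, so that adding these endpoints to the list gives
    a strictly increasing sequence.\<close>
  define Z where "Z = {x. polyval n a x = 0} \<inter> {0<..<1}"
  have fin0: "finite {x. polyval n a x = 0}" and card0: "card {x. polyval n a x = 0} \<le> n"
    using nz polyfun_rootbound[where c = a and n = n] unfolding polyval_def by blast+
  then have fin: "finite Z" and card: "card Z \<le> n"
    using card_mono[OF fin0, of Z] by (auto simp: Z_def)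
  \<comment> \<open>The list has \<open>card Z + 2\<close> entries, so its last index is
    \<open>Suc (card Z)\<close> and the number k of \<open>sign_pieces\<close> is
    \<open>card Z\<close>.\<close>
  define L where "L = 0 # sorted_list_of_set Z @ [1]"
  define t where "t i = L ! i" for i
  have len: "length L = Suc (Suc (card Z))"
    by (simp add: L_def)
  have srt: "sorted_wrt (<) L"
    using fin by (auto simp: L_def sorted_wrt_append Z_def)
  have setL: "set L = insert 0 (insert 1 Z)"
    using fin by (auto simp: L_def)
  have mono: "t i < t j" if "i < j" "j \<le> Suc (card Z)" for i j
    unfolding t_def using that by (intro sorted_wrt_nth_less[OF srt]) (auto simp: len)
  have t0: "t 0 = 0" and t1: "t (Suc (card Z)) = 1"
    by (simp_all add: t_def L_def nth_append)
  have nz_between: "polyval n a x \<noteq> 0" if i: "i \<le> card Z" and x: "t i < x" "x < t (Suc i)" for i x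
  proof
    \<comment> \<open>Such a root would lie in (0,1) and so be an entry of \<open>L\<close>, but no
      entry lies strictly between two neighbours.\<close>
    assume "polyval n a x = 0"
    moreover have "0 \<le> t i" "t (Suc i) \<le> 1"
      using mono[of 0 i] mono[of "Suc i" "Suc (card Z)"] t0 t1 i
      by (cases "i = 0"; cases "i = card Z"; simp)+
    ultimately have "x \<in> set L"
      using x by (auto simp: setL Z_def)
    then obtain j where j: "j \<le> Suc (card Z)" "x = t j"
      by (auto simp: in_set_conv_nth len t_def less_Suc_eq_le)
    have "\<not> j \<le> i"
      using mono[of j i] x i j by (cases "j = i") auto
    moreover have "\<not> Suc i \<le> j"
      using mono[of "Suc i" j] x j by (cases "j = Suc i") auto
    ultimately show False by simp
  qed
  have "(AE x in lebesgue_on {t i..t (Suc i)}. sgn (polyval n a x) = 1) \<or>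
        (AE x in lebesgue_on {t i..t (Suc i)}. sgn (polyval n a x) = -1)" if i: "i \<le> card Z" for i
  proof -
    have int: "AE x in lebesgue_on {t i..t (Suc i)}. t i < x \<and> x < t (Suc i)"
    proof -
      have "AE x in lebesgue_on {t i..t (Suc i)}. x \<in> {t i..t (Suc i)}"
        by (rule AE_I2) simp
      moreover have "AE x in lebesgue_on {t i..t (Suc i)}. x \<notin> {t i, t (Suc i)}"
        by (rule AE_lebesgue_on_notin_finite) auto
      ultimately show ?thesis
        by eventually_elim auto
    qed
    from sgn_constant_between_zeros[OF continuous_on_polyval nz_between[OF i]]
    show ?thesis
    proof
      assume "\<forall>x. t i < x \<and> x < t (Suc i) \<longrightarrow> sgn (polyval n a x) = 1"
      with int show ?thesis by (intro disjI1) (auto elim: eventually_mono)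
    next
      assume "\<forall>x. t i < x \<and> x < t (Suc i) \<longrightarrow> sgn (polyval n a x) = -1"
      with int show ?thesis by (intro disjI2) (auto elim: eventually_mono)
    qed
  qed
  then show ?thesis
    unfolding sign_pieces_def using card t0 t1 mono
    by (intro exI[of _ "card Z"] conjI exI[of _ t]) auto
qed

section \<open>The class map from the sphere onto \<open>sign_space n\<close>\<close>

definition sgn_class :: "nat \<Rightarrow> (nat \<Rightarrow> real) \<Rightarrow> (real \<Rightarrow> real) set"
  where "sgn_class n a = L1_eq `` {\<lambda>x. sgn (polyval n a x)}"

lemma sgn_class_in_L1: "sgn_class n a \<in> L1"
  unfolding sgn_class_def L1_def by (rule quotientI) (simp add: integrable_sgn_polyval)

lemma sgn_polyval_in_sgn_class: "(\<lambda>x. sgn (polyval n a x)) \<in> sgn_class n a"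
  unfolding sgn_class_def
  by (rule equiv_class_self[OF equiv_L1_eq]) (simp add: integrable_sgn_polyval)

lemma sgn_class_eq_iff:
  "sgn_class n a = sgn_class n b \<longleftrightarrow> (AE x in unit_meas. sgn (polyval n a x) = sgn (polyval n b x))"
  unfolding sgn_class_def
  by (subst eq_equiv_class_iff[OF equiv_L1_eq]) (auto simp: integrable_sgn_polyval L1_eq_def)

lemma sgn_class_image: "sgn_class n ` topspace (nsphere n) = sign_space n"
proof (intro equalityI subsetI)
  fix F assume "F \<in> sgn_class n ` topspace (nsphere n)"
  then show "F \<in> sign_space n"
    unfolding sign_space_def
    using sgn_class_in_L1 sgn_polyval_in_sgn_class sign_pieces_sgn_polyval nsphere_nonzero by blast
next
  fix F assume "F \<in> sign_space n"
  then obtain f where F: "F \<in> L1" "f \<in> F" "sign_pieces n f"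
    by (auto simp: sign_space_def)
  obtain a where a: "a \<in> topspace (nsphere n)" "AE x in unit_meas. f x = sgn (polyval n a x)"
    using sign_pieces_imp_sgn_polyval[OF F(3)] by blast
  have "(f, \<lambda>x. sgn (polyval n a x)) \<in> L1_eq"
    using a L1_integrable[OF F(1,2)] by (auto simp: L1_eq_def integrable_sgn_polyval)
  then have "F = sgn_class n a"
    using quotient_eq_iff[OF equiv_L1_eq F(1)[unfolded L1_def] sgn_class_in_L1[unfolded L1_def]
        F(2) sgn_polyval_in_sgn_class] by blast
  with a show "F \<in> sgn_class n ` topspace (nsphere n)" by blast
qed

text \<open>The L^1 distance to the class of a fixed a is an integral of a bounded function of sgn
  p_b, so the limit lemma for such integrals makes it continuous in b; its sublevel sets are the
  required neighbourhoods.\<close>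

lemma continuous_map_sgn_class: "continuous_map (nsphere n) L1.mtopology (sgn_class n)"
  unfolding L1.continuous_map_to_metric
proof (intro ballI allI impI)
  fix a :: "nat \<Rightarrow> real" and \<epsilon> :: real assume a: "a \<in> topspace (nsphere n)" and "\<epsilon> > 0"
  define D where "D b = (LINT x|unit_meas. \<bar>sgn (polyval n a x) - sgn (polyval n b x)\<bar>)" for b
  have dist: "L1_dist (sgn_class n a) (sgn_class n b) = D b" for b
    unfolding D_def by (intro L1_dist_eq sgn_class_in_L1 sgn_polyval_in_sgn_class)
  have "continuous_on (topspace (nsphere n)) D"
    unfolding D_def
  proof (rule continuous_on_nonzero_coeffsI,
      rule integral_sgn_polyval_tendsto[where B = 2 and f = "\<lambda>s x. \<bar>sgn (polyval n a x) - s\<bar>"])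
    show "\<bar>\<bar>sgn (polyval n a x) - s\<bar>\<bar> \<le> 2" if "\<bar>s\<bar> \<le> 1" for s x
      using that abs_sgn_le_1[of "polyval n a x"] by linarith
    show "(\<lambda>x. \<bar>sgn (polyval n a x) - s\<bar>) \<in> borel_measurable unit_meas" for s
      by measurable
  qed (auto intro: nsphere_nonzero)
  then have "continuous_map (nsphere n) euclideanreal D"
    by (subst nsphere_eq_top_of_set) simp
  then have "openin (nsphere n) {b \<in> topspace (nsphere n). D b \<in> {..<\<epsilon>}}"
    by (rule openin_continuous_map_preimage) simp
  moreover have "D a = 0" by (simp add: D_def)
  ultimately show "\<exists>U. openin (nsphere n) U \<and> a \<in> U \<and> (\<forall>b\<in>U. sgn_class n b \<in> L1.mball (sgn_class n a) \<epsilon>)"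
    using a \<open>\<epsilon> > 0\<close>
    by (intro exI[of _ "{b \<in> topspace (nsphere n). D b \<in> {..<\<epsilon>}}"])
       (auto simp: sgn_class_in_L1 dist)
qed

section \<open>The normalized moment map T\<close>

definition moment_direction :: "nat \<Rightarrow> (nat \<Rightarrow> real) \<Rightarrow> nat \<Rightarrow> real"
  where "moment_direction n a = sphere_normalize n (sgn_moment n a)"

lemma continuous_map_moment_direction:
  "continuous_map (nsphere n) (nsphere n) (moment_direction n)"
proof -
  have "continuous_on (topspace (nsphere n)) (\<lambda>a. moment_direction n a i)" for i
  proof (rule continuous_on_nonzero_coeffsI)
    fix a and b :: "nat \<Rightarrow> nat \<Rightarrow> real"
    assume nz: "\<exists>i\<le>n. a i \<noteq> 0" and lim: "\<And>i. i \<le> n \<Longrightarrow> (\<lambda>k. b k i) \<longlonglongrightarrow> a i"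
    have "sqrt (\<Sum>j\<le>n. (sgn_moment n a j)\<^sup>2) \<noteq> 0"
      using sum_squares_pos[OF sgn_moment_nonzero[OF nz]] by simp
    moreover have "(\<lambda>k. sgn_moment n (b k) j) \<longlonglongrightarrow> sgn_moment n a j" for j
      by (rule sgn_moment_tendsto[OF nz lim])
    ultimately show "(\<lambda>k. moment_direction n (b k) i) \<longlonglongrightarrow> moment_direction n a i"
      unfolding moment_direction_def sphere_normalize_def
      by (cases "i \<le> n") (auto intro!: tendsto_divide tendsto_real_sqrt tendsto_sum tendsto_power)
  qed (rule nsphere_nonzero)
  then have "continuous_on (topspace (nsphere n)) (moment_direction n)"
    by (rule continuous_on_coordinatewise_then_product)
  moreover have "moment_direction n a \<in> topspace (nsphere n)" if "a \<in> topspace (nsphere n)" for a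
    unfolding moment_direction_def
    by (intro sphere_normalize_in_nsphere sgn_moment_nonzero nsphere_nonzero that)
  ultimately show ?thesis
    by (subst (1 2) nsphere_eq_top_of_set) auto
qed

lemma moment_direction_surj: "moment_direction n ` topspace (nsphere n) = topspace (nsphere n)"
proof (intro equalityI)
  show "moment_direction n ` topspace (nsphere n) \<subseteq> topspace (nsphere n)"
    by (rule continuous_map_image_subset_topspace[OF continuous_map_moment_direction])
  show "topspace (nsphere n) \<subseteq> moment_direction n ` topspace (nsphere n)"
  proof
    fix c assume c: "c \<in> topspace (nsphere n)"
    obtain a M where a: "a \<in> topspace (nsphere n)" and M: "M > 0"
        and eq: "\<And>i. i \<le> n \<Longrightarrow> c i = M * sgn_moment n a i"
      using sgn_moment_surj[OF c] by blast
    have nz: "\<exists>i\<le>n. sgn_moment n a i \<noteq> 0"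
      using a by (intro sgn_moment_nonzero nsphere_nonzero)
    let ?S = "sqrt (\<Sum>j\<le>n. (sgn_moment n a j)\<^sup>2)"
    have "(\<Sum>i\<le>n. (c i)\<^sup>2) = 1" and c0: "\<And>i. i > n \<Longrightarrow> c i = 0"
      using c by (auto simp: topspace_nsphere)
    \<comment> \<open>The unit length of c forces M to be the reciprocal of the norm of the moment
      vector.\<close>
    then have "M\<^sup>2 * (\<Sum>j\<le>n. (sgn_moment n a j)\<^sup>2) = 1"
      by (simp add: eq power_mult_distrib sum_distrib_left)
    then have "sqrt (M\<^sup>2 * (\<Sum>j\<le>n. (sgn_moment n a j)\<^sup>2)) = 1"
      by simp
    then have "M * ?S = 1"
      using M by (simp add: real_sqrt_mult)
    then have "M = 1 / ?S"
      by (metis mult_zero_right nonzero_eq_divide_eq zero_neq_one)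
    then have "moment_direction n a i = c i" for i
      using eq[of i] c0[of i] by (auto simp: moment_direction_def sphere_normalize_def)
    then have "c = moment_direction n a" by auto
    with a show "c \<in> moment_direction n ` topspace (nsphere n)" by blast
  qed
qed

text \<open>The two maps have the same fibres: equal directions mean moments proportional by a
  positive factor, which determines the sign almost everywhere; conversely, moments depend only on
  the class.\<close>

lemma moment_direction_eq_iff:
  assumes a: "a \<in> topspace (nsphere n)" and b: "b \<in> topspace (nsphere n)"
  shows "moment_direction n a = moment_direction n b \<longleftrightarrow> sgn_class n a = sgn_class n b"
proof
  have nz: "\<exists>i\<le>n. a i \<noteq> 0" "\<exists>i\<le>n. b i \<noteq> 0"
    using a b by (auto dest: nsphere_nonzero)
  assume eq: "moment_direction n a = moment_direction n b"
  obtain r where r: "r > 0" "\<And>i. i \<le> n \<Longrightarrow> moment_direction n a i = r * sgn_moment n a i"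
    unfolding moment_direction_def using sphere_normalize_scale[OF sgn_moment_nonzero[OF nz(1)]] by blast
  obtain q where q: "q > 0" "\<And>i. i \<le> n \<Longrightarrow> moment_direction n b i = q * sgn_moment n b i"
    unfolding moment_direction_def using sphere_normalize_scale[OF sgn_moment_nonzero[OF nz(2)]] by blast
  have "sgn_moment n a i = (q / r) * sgn_moment n b i" if "i \<le> n" for i
    using r q eq that by (simp add: field_simps)
  then show "sgn_class n a = sgn_class n b"
    unfolding sgn_class_eq_iff using r q
    by (intro sgn_eq_if_moments_proportional[OF nz, of "q / r"]) auto
next
  assume "sgn_class n a = sgn_class n b"
  then have "AE x in unit_meas. sgn (polyval n a x) = sgn (polyval n b x)"
    by (simp add: sgn_class_eq_iff)
  then have "AE x in unit_meas. sgn (polyval n a x) * x ^ i = sgn (polyval n b x) * x ^ i" for i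
    by eventually_elim simp
  then have "sgn_moment n a = sgn_moment n b"
    unfolding sgn_moment_def
    by (intro ext integral_cong_AE borel_measurable_integrable integrable_sgn_power)
  then show "moment_direction n a = moment_direction n b"
    by (simp add: moment_direction_def)
qed

section \<open>Factoring the moment map through the class map\<close>

theorem theorem4:
  fixes n :: nat
  shows "subtopology L1.mtopology (sign_space n) homeomorphic_space nsphere n"
proof -
  let ?X = "nsphere n" and ?Y = "subtopology L1.mtopology (sign_space n)"
  have topY: "topspace ?Y = sign_space n"
    by (auto simp: sign_space_def)
  have contY: "continuous_map ?X ?Y (sgn_class n)"
    using sgn_class_image by (auto simp: continuous_map_in_subtopology continuous_map_sgn_class)
  have hausX: "Hausdorff_space ?X"
    by (subst nsphere_eq_top_of_set) (simp add: Hausdorff_space_subtopology)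
  have hausY: "Hausdorff_space ?Y"
    by (intro Hausdorff_space_subtopology L1.Hausdorff_space_mtopology)
  \<comment> \<open>A continuous surjection from a compact space to a Hausdorff space is a quotient
    map.\<close>
  have quot: "quotient_map ?X ?Y (sgn_class n)"
    by (rule continuous_imp_quotient_map[OF contY compact_space_nsphere hausY])
       (simp only: sgn_class_image topY)
  have "compactin ?Y (sgn_class n ` topspace ?X)"
    using image_compactin[OF _ contY] compact_space_nsphere compact_space_def by blast
  then have compY: "compact_space ?Y"
    by (simp only: sgn_class_image compact_space_def topY)
  \<comment> \<open>The moment map is constant on the fibres of the class map, so it descends to the
    quotient.\<close>
  obtain g where g: "continuous_map ?Y ?X g" "g ` topspace ?Y = moment_direction n ` topspace ?X"
      "\<And>a. a \<in> topspace ?X \<Longrightarrow> g (sgn_class n a) = moment_direction n a"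
    using quotient_map_lift_exists[OF quot continuous_map_moment_direction] moment_direction_eq_iff
    by metis
  \<comment> \<open>The converse comparison of fibres gives injectivity; a continuous bijection from
    a compact to a Hausdorff space is then a homeomorphism.\<close>
  have "inj_on g (topspace ?Y)"
    unfolding topY sgn_class_image[symmetric]
    by (rule inj_onI) (auto simp: g(3) moment_direction_eq_iff)
  then have "homeomorphic_map ?Y ?X g"
    using g(2) moment_direction_surj
    by (intro continuous_imp_homeomorphic_map[OF g(1) compY hausX]) auto
  then show ?thesis
    by (rule homeomorphic_map_imp_homeomorphic_space)
qed

end
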